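(* The expected reset threshold of a uniformly random synchronizing binary $n$-state decoder is $O(n\log n)$.
   Context: A finite prefix code $\mathcal{T}\subseteq\Sigma^*$ is a finite non-empty set of non-empty words none of which is a prefix of another; it is maximal if adding any word destroys this property. Its decoder is the DFA with states $Q=\{q_v\mid v \text{ a proper prefix of a word of }\mathcal{T}\}$ and transitions $\delta(q_v,a)=q_{va}$ if $va\notin\mathcal{T}$, and $\delta(q_v,a)=q_\varepsilon$ if $va\in\mathcal{T}$. Binary $n$-state decoders (over a fixed 2-letter alphabet, $n=|Q|$) are in bijection with binary trees with $n$ internal nodes (so there are Catalan-number many); a uniformly random synchronizing binary $n$-state decoder is drawn uniformly from those that are synchronizing, i.e. have a word $w$ with $|\{\delta(q,w)\mid q\in Q\}|=1$. The reset threshold is the length of a shortest such word. *)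

theory Defs
  imports Main "HOL-Library.Sublist" "HOL-Library.Landau_Symbols"
begin

definition prefix_code :: "bool list set \<Rightarrow> bool" where
  "prefix_code T \<longleftrightarrow> finite T \<and> T \<noteq> {} \<and> [] \<notin> T \<and>
     (\<forall>u\<in>T. \<forall>v\<in>T. prefix u v \<longrightarrow> u = v)"

definition maximal_prefix_code :: "bool list set \<Rightarrow> bool" where
  "maximal_prefix_code T \<longleftrightarrow> prefix_code T \<and>
     (\<forall>w. w \<notin> T \<longrightarrow> \<not> prefix_code (insert w T))"

text \<open>States of the decoder: proper prefixes of code words (q_v identified with v).\<close>
definition dec_states :: "bool list set \<Rightarrow> bool list set" where
  "dec_states T = {v. \<exists>t\<in>T. strict_prefix v t}"

definition dec_delta :: "bool list set \<Rightarrow> bool list \<Rightarrow> bool \<Rightarrow> bool list" where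
  "dec_delta T v a = (if v @ [a] \<in> T then [] else v @ [a])"

definition dec_delta_word :: "bool list set \<Rightarrow> bool list \<Rightarrow> bool list \<Rightarrow> bool list" where
  "dec_delta_word T q w = fold (\<lambda>a v. dec_delta T v a) w q"

definition synchronizing_word :: "bool list set \<Rightarrow> bool list \<Rightarrow> bool" where
  "synchronizing_word T w \<longleftrightarrow> card ((\<lambda>q. dec_delta_word T q w) ` dec_states T) = 1"

definition synchronizing :: "bool list set \<Rightarrow> bool" where
  "synchronizing T \<longleftrightarrow> (\<exists>w. synchronizing_word T w)"

definition reset_threshold :: "bool list set \<Rightarrow> nat" where
  "reset_threshold T = (LEAST k. \<exists>w. length w = k \<and> synchronizing_word T w)"

text \<open>Binary n-state decoders, represented by their (maximal) prefix codes.\<close>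
definition decoders :: "nat \<Rightarrow> bool list set set" where
  "decoders n = {T. maximal_prefix_code T \<and> card (dec_states T) = n}"

definition sync_decoders :: "nat \<Rightarrow> bool list set set" where
  "sync_decoders n = {T \<in> decoders n. synchronizing T}"

definition expected_reset_threshold :: "nat \<Rightarrow> real" where
  "expected_reset_threshold n =
     (\<Sum>T\<in>sync_decoders n. real (reset_threshold T)) / real (card (sync_decoders n))"

end

theory Submission
  imports Defs "HOL-Library.Function_Algebras"
begin

text \<open>The expectation is in fact linear in \<open>n\<close>. Let \<open>h\<close> be the length of the code word \<open>0\<^sup>h\<close>, i.e. of the
  leftmost branch of the tree. The word \<open>w = 0\<^sup>n\<close> sends all states to the \<open>h\<close> states on that branch.
  On these states a linear algebra argument shows that the words \<open>u w\<close> with \<open>length u \<le> n\<close> already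
  suffice to synchronize, and merging pairs greedily takes at most \<open>h\<^sup>3\<close> of them, which gives the bound
  \<open>n + 2 n h\<^sup>3\<close> for the reset threshold.

  The third moment of \<open>h\<close> over random trees is bounded: inserting a node at one of the \<open>h + 1\<close>
  positions of the leftmost branch is injective, so three insertions bound \<open>\<Sum> h\<^sup>3\<close> by a multiple of
  the number of trees with \<open>n + 3\<close> nodes. Since the number of trees grows by a factor of at most 4, and
  all trees with \<open>h = 1\<close> are synchronizing, conditioning on synchronizability costs only a constant.\<close>

section \<open>Reset words of automata with a low-rank word\<close>

fun run :: "('s \<Rightarrow> 'a \<Rightarrow> 's) \<Rightarrow> 's \<Rightarrow> 'a list \<Rightarrow> 's" where
  "run \<delta> q [] = q"
| "run \<delta> q (a # w) = run \<delta> (\<delta> q a) w"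

lemma run_append [simp]: "run \<delta> q (u @ v) = run \<delta> (run \<delta> q u) v"
  by (induction u arbitrary: q) auto

lemma run_run: "run (run \<delta>) q ws = run \<delta> q (concat ws)"
  by (induction ws arbitrary: q) auto

lemma run_closed:
  assumes "\<And>q a. q \<in> Q \<Longrightarrow> a \<in> A \<Longrightarrow> \<delta> q a \<in> Q" "q \<in> Q" "w \<in> lists A"
  shows "run \<delta> q w \<in> Q"
  using assms(3,2) by (induction w arbitrary: q) (auto intro: assms(1))

interpretation fun_space: vector_space "\<lambda>(c::real) (f :: 's \<Rightarrow> real) x. c * f x"
  by unfold_locales (auto simp: fun_eq_iff algebra_simps)

lemma finite_support_span:
  assumes "finite Q" "\<And>x. x \<notin> Q \<Longrightarrow> f x = 0"
  shows "f \<in> fun_space.span ((\<lambda>q x. if x = q then 1 else 0) ` Q)"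
proof -
  have "f = (\<Sum>q\<in>Q. (\<lambda>x. f q * (if x = q then 1 else 0)))"
  proof
    fix x
    have sum_app: "(\<Sum>q\<in>P. g q) x = (\<Sum>q\<in>P. g q x)" if "finite P" for P and g :: "'a \<Rightarrow> 'a \<Rightarrow> real"
      using that by (induction P) auto
    show "f x = (\<Sum>q\<in>Q. (\<lambda>x. f q * (if x = q then 1 else 0))) x"
      using assms by (auto simp: sum_app if_distrib cong: if_cong)
  qed
  also have "\<dots> \<in> fun_space.span ((\<lambda>q x. if x = q then 1 else 0) ` Q)"
    by (intro fun_space.span_sum fun_space.span_scale fun_space.span_base) auto
  finally show ?thesis .
qed

text \<open>The spans of the functions \<open>q \<mapsto> g (q \<cdot> u)\<close> with \<open>length u \<le> k\<close> increase with \<open>k\<close> inside a space of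
  dimension \<open>card Q\<close>, and they stop growing once two consecutive ones coincide.\<close>
lemma linear_output_short_words:
  fixes g :: "'s \<Rightarrow> real"
  assumes fin: "finite Q" and cl: "\<And>q a. q \<in> Q \<Longrightarrow> \<delta> q a \<in> Q" and X: "X \<subseteq> Q"
    and short: "\<And>u. length u \<le> card Q \<Longrightarrow> (\<Sum>x\<in>X. g (run \<delta> x u)) = 0"
  shows "(\<Sum>x\<in>X. g (run \<delta> x u)) = 0"
proof -
  define F where "F u = (\<lambda>q. if q \<in> Q then g (run \<delta> q u) else 0)" for u
  define V where "V k = fun_space.span (F ` {u. length u \<le> k})" for k
  have V_mono: "V j \<subseteq> V k" if "j \<le> k" for j k
    unfolding V_def using that by (intro fun_space.span_mono) auto
  define n where "n = card Q"
  obtain k where k: "k \<le> n" "\<And>u. length u = Suc k \<Longrightarrow> F u \<in> V k"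
  proof (rule ccontr)
    assume "\<not> thesis"
    with that have "\<forall>k\<le>n. \<exists>u. length u = Suc k \<and> F u \<notin> V k" by blast
    then obtain U where U: "\<And>k. k \<le> n \<Longrightarrow> length (U k) = Suc k \<and> F (U k) \<notin> V k" by metis
    have ind: "m \<le> Suc n \<Longrightarrow> fun_space.independent ((F \<circ> U) ` {..<m}) \<and> card ((F \<circ> U) ` {..<m}) = m" for m
    proof (induction m)
      case 0
      then show ?case by (simp add: fun_space.independent_empty)
    next
      case (Suc m)
      have "fun_space.span ((F \<circ> U) ` {..<m}) \<subseteq> V m"
        unfolding V_def
      proof (rule fun_space.span_mono)
        have "length (U i) \<le> m" if "i < m" for i
          using U[of i] Suc.prems that by simp
        then show "(F \<circ> U) ` {..<m} \<subseteq> F ` {u. length u \<le> m}" by auto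
      qed
      moreover have "F (U m) \<notin> V m" using U Suc.prems by auto
      ultimately have ns: "F (U m) \<notin> fun_space.span ((F \<circ> U) ` {..<m})"
        by (rule contra_subsetD)
      moreover from ns have "F (U m) \<notin> (F \<circ> U) ` {..<m}"
        by (rule contrapos_nn) (rule fun_space.span_base)
      moreover have "(F \<circ> U) ` {..<Suc m} = insert (F (U m)) ((F \<circ> U) ` {..<m})"
        by (simp add: lessThan_Suc)
      moreover have "fun_space.independent ((F \<circ> U) ` {..<m})" "card ((F \<circ> U) ` {..<m}) = m"
        using Suc.IH Suc.prems by simp_all
      ultimately show ?case using fun_space.independent_insertI[OF ns] by (simp del: image_comp)
    qed
    let ?E = "(\<lambda>q x. if x = q then 1 else (0::real)) ` Q"
    have "(F \<circ> U) ` {..<Suc n} \<subseteq> fun_space.span ?E"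
    proof (clarsimp, rule finite_support_span[OF fin])
      show "F (U i) x = 0" if "x \<notin> Q" for i x using that by (simp add: F_def)
    qed
    then have "card ((F \<circ> U) ` {..<Suc n}) \<le> card ?E"
      using fun_space.independent_span_bound[of ?E] fin ind[of "Suc n"] by blast
    also have "\<dots> \<le> n" unfolding n_def using fin by (rule card_image_le)
    finally show False using ind[of "Suc n"] by auto
  qed
  have "F u \<in> V k" for u
  proof (induction u)
    case Nil
    then show ?case unfolding V_def by (intro fun_space.span_base) auto
  next
    case (Cons a u)
    define S where "S f = (\<lambda>q. if q \<in> Q then f (\<delta> q a) else (0::real))" for f
    have SF: "S (F v) = F (a # v)" for v
      unfolding S_def F_def using cl by (auto simp: fun_eq_iff)
    have "S f \<in> V k" if "f \<in> V k" for f
      using that unfolding V_def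
    proof (induction rule: fun_space.span_induct_alt)
      case base
      have "S 0 = 0" by (auto simp: S_def fun_eq_iff)
      then show ?case using fun_space.span_zero by metis
    next
      case (step c x y)
      then obtain v where v: "x = F v" "length v \<le> k" by auto
      have "F (a # v) \<in> V k"
      proof (cases "length v = k")
        case True
        then show ?thesis using k(2)[of "a # v"] by simp
      next
        case False
        then show ?thesis using v unfolding V_def by (intro fun_space.span_base) auto
      qed
      moreover have "S ((\<lambda>q. c * x q) + y) = (\<lambda>q. c * F (a # v) q) + S y"
        unfolding SF[symmetric] v by (auto simp: S_def fun_eq_iff)
      ultimately show ?case
        using step fun_space.span_add fun_space.span_scale unfolding V_def by metis
    qed
    then show ?case using Cons SF by metis
  qed
  moreover have "(\<Sum>x\<in>X. f x) = 0" if "f \<in> V k" for f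
    using that unfolding V_def
  proof (induction rule: fun_space.span_induct_alt)
    case base
    then show ?case by simp
  next
    case (step c f h)
    then obtain v where v: "f = F v" "length v \<le> k" by auto
    have "(\<Sum>x\<in>X. F v x) = (\<Sum>x\<in>X. g (run \<delta> x v))"
      unfolding F_def using X by (intro sum.cong) auto
    also have "\<dots> = 0" using v k(1) by (intro short) (auto simp: n_def)
    finally show ?case using step v by (simp add: sum.distrib sum_distrib_left[symmetric])
  qed
  ultimately have "(\<Sum>x\<in>X. F u x) = 0" by blast
  moreover have "(\<Sum>x\<in>X. F u x) = (\<Sum>x\<in>X. g (run \<delta> x u))"
    unfolding F_def using X by (intro sum.cong) auto
  ultimately show ?thesis by simp
qed

text \<open>Take \<open>t\<close> of minimal rank over the letters \<open>u @ w\<close>. Every further letter permutes its image \<open>X\<close> up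
  to \<open>t\<close>, so exactly one point of \<open>X\<close> reaches a given \<open>y\<close>. This is a linear condition on \<open>u\<close>, hence it
  holds for every \<open>u\<close>; a synchronizing \<open>u\<close> then forces \<open>card X = 1\<close>.\<close>
lemma short_letters_collapse:
  assumes fin: "finite Q" and cl: "\<And>q a. q \<in> Q \<Longrightarrow> \<delta> q a \<in> Q"
    and sync: "\<And>p q. p \<in> Q \<Longrightarrow> q \<in> Q \<Longrightarrow> run \<delta> p s = run \<delta> q s"
    and C: "C = (\<lambda>q. run \<delta> q w) ` Q" and B: "B = {u @ w | u. length u \<le> card Q}"
  obtains t where "t \<in> lists B" "\<And>p q. p \<in> C \<Longrightarrow> q \<in> C \<Longrightarrow> run (run \<delta>) p t = run (run \<delta>) q t"
proof (cases "Q = {}")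
  case True
  then show ?thesis using that[of "[]"] C by auto
next
  case ne: False
  have clw: "run \<delta> q v \<in> Q" if "q \<in> Q" for q v
    using run_closed[of Q UNIV \<delta>] cl that by auto
  have CQ: "C \<subseteq> Q" and finC: "finite C" and neC: "C \<noteq> {}"
    using C clw fin ne by auto
  have clB: "run \<delta> q b \<in> C" if "q \<in> C" "b \<in> B" for q b
    using that C B CQ clw by auto
  have clBs: "run (run \<delta>) q v \<in> C" if "q \<in> C" "v \<in> lists B" for q v
    using run_closed[of C B "run \<delta>"] clB that by auto
  let ?r = "run (run \<delta>)"
  define rk where "rk t = card ((\<lambda>q. ?r q t) ` C)" for t
  obtain t where t: "t \<in> lists B" and min: "\<And>t'. t' \<in> lists B \<Longrightarrow> rk t \<le> rk t'"
    using ex_has_least_nat[of "\<lambda>t. t \<in> lists B" "[]" rk] by auto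
  define X where "X = (\<lambda>q. ?r q t) ` C"
  have X: "finite X" "X \<subseteq> C" "X \<noteq> {}" using finC clBs t neC by (auto simp: X_def)
  define m where "m = real (card X)"
  have m: "m > 0" using X by (auto simp: m_def card_gt_0_iff)
  obtain y where y: "y \<in> X" using X by auto
  define g where "g q = (if ?r (run \<delta> q w) t = y then 1 else 0) - 1 / m" for q
  have "(\<Sum>x\<in>X. g (run \<delta> x u)) = 0" if "length u \<le> card Q" for u
  proof -
    define \<phi> where "\<phi> x = ?r (run \<delta> x (u @ w)) t" for x
    have uw: "u @ w \<in> B" using that B by auto
    have sub: "\<phi> ` X \<subseteq> X"
      proof (rule image_subsetI)
      fix x assume "x \<in> X"
      then have "run \<delta> x (u @ w) \<in> C" using clB[OF _ uw] X(2) by blast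
      then show "\<phi> x \<in> X" unfolding \<phi>_def X_def by blast
    qed
    have "(\<lambda>q. ?r q (t @ [u @ w] @ t)) ` C = \<phi> ` X"
      by (simp add: X_def \<phi>_def image_image)
    then have "card X \<le> card (\<phi> ` X)"
      using min[of "t @ [u @ w] @ t"] t uw by (auto simp: rk_def X_def)
    then have "\<phi> ` X = X" using sub X(1) by (simp add: card_seteq)
    then have bij: "bij_betw \<phi> X X"
      using X(1) by (simp add: bij_betw_def eq_card_imp_inj_on)
    have "(\<Sum>x\<in>X. if \<phi> x = y then 1 else 0) = (\<Sum>x\<in>X. if x = y then 1 else (0::real))"
      by (rule sum.reindex_bij_betw[OF bij])
    also have "\<dots> = 1" using X y by simp
    finally show ?thesis using m by (simp add: g_def \<phi>_def sum_subtractf m_def)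
  qed
  then have "(\<Sum>x\<in>X. g (run \<delta> x s)) = 0"
    using linear_output_short_words[of Q \<delta> X g s] fin cl X CQ by blast
  moreover have "(\<Sum>x\<in>X. g (run \<delta> x s)) = (\<Sum>x\<in>X. g (run \<delta> y s))"
  proof (rule sum.cong)
    show "g (run \<delta> x s) = g (run \<delta> y s)" if "x \<in> X" for x
      using sync[of x y] that y X(2) CQ by (metis subsetD)
  qed simp
  ultimately have "m * g (run \<delta> y s) = 0" by (simp add: m_def)
  then have "m = 1" using m by (auto simp: g_def split: if_splits)
  then have "card X = 1" by (simp add: m_def)
  then obtain z where "X = {z}" by (auto simp: card_1_singleton_iff)
  then have "?r p t = z" if "p \<in> C" for p using that unfolding X_def by blast
  then show ?thesis using that[OF t] by metis
qed

lemma short_pair_merge: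
  assumes fin: "finite C" and cl: "\<And>q a. q \<in> C \<Longrightarrow> a \<in> B \<Longrightarrow> \<delta> q a \<in> C"
    and pq: "p \<in> C" "q \<in> C" and t: "t \<in> lists B" "run \<delta> p t = run \<delta> q t"
  obtains v where "v \<in> lists B" "length v \<le> card C ^ 2" "run \<delta> p v = run \<delta> q v"
proof -
  obtain v where v: "v \<in> lists B" "run \<delta> p v = run \<delta> q v"
    and min: "\<And>v'. v' \<in> lists B \<Longrightarrow> run \<delta> p v' = run \<delta> q v' \<Longrightarrow> length v \<le> length v'"
    using ex_has_least_nat[of "\<lambda>v. v \<in> lists B \<and> run \<delta> p v = run \<delta> q v" t length] t by blast
  define f where "f i = (run \<delta> p (take i v), run \<delta> q (take i v))" for i
  have tk: "take i v \<in> lists B" "drop i v \<in> lists B" for i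
    using v(1) by (auto dest: in_set_takeD in_set_dropD)
  have "f i \<noteq> f j" if "i < j" "j \<le> length v" for i j
  proof
    assume eq: "f i = f j"
    let ?v = "take i v @ drop j v"
    have "run \<delta> p ?v = run \<delta> p (take j v @ drop j v)"
      "run \<delta> q ?v = run \<delta> q (take j v @ drop j v)"
      using eq unfolding run_append f_def by simp_all
    then have "run \<delta> p ?v = run \<delta> q ?v" using v(2) by simp
    then have "length v \<le> length ?v" using min tk by (metis append_in_lists_conv)
    then show False using that by simp
  qed
  then have "inj_on f {..length v}"
    by (intro linorder_inj_onI) (auto simp: le_cases)
  moreover have "f ` {..length v} \<subseteq> C \<times> C"
    using pq tk run_closed[of C B \<delta>] cl by (auto simp: f_def)
  ultimately have "card {..length v} \<le> card (C \<times> C)"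
    using fin by (intro card_inj_on_le) auto
  then have "length v \<le> card C ^ 2" by (simp add: card_cartesian_product power2_eq_square)
  then show ?thesis using that v by blast
qed

lemma short_collapse:
  assumes fin: "finite C" and cl: "\<And>q a. q \<in> C \<Longrightarrow> a \<in> B \<Longrightarrow> \<delta> q a \<in> C"
    and t: "t \<in> lists B" "\<And>p q. p \<in> C \<Longrightarrow> q \<in> C \<Longrightarrow> run \<delta> p t = run \<delta> q t"
    and X: "X \<subseteq> C"
  shows "\<exists>v\<in>lists B. length v \<le> card X * card C ^ 2 \<and> (\<forall>p\<in>X. \<forall>q\<in>X. run \<delta> p v = run \<delta> q v)"
  using X
proof (induction "card X" arbitrary: X rule: less_induct)
  case less
  have finX: "finite X" using less.prems fin finite_subset by auto
  show ?case
  proof (cases "\<exists>p\<in>X. \<exists>q\<in>X. p \<noteq> q")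
    case False
    then show ?thesis by (intro bexI[of _ "[]"]) auto
  next
    case True
    then obtain p q where pq: "p \<in> X" "q \<in> X" "p \<noteq> q" by auto
    have pqC: "p \<in> C" "q \<in> C" using pq less.prems by auto
    obtain v where v: "v \<in> lists B" "length v \<le> card C ^ 2" "run \<delta> p v = run \<delta> q v"
      using short_pair_merge[of C B \<delta> p q t] fin cl pqC t by metis
    let ?Y = "(\<lambda>x. run \<delta> x v) ` X"
    have "\<not> inj_on (\<lambda>x. run \<delta> x v) X" using pq v by (auto simp: inj_on_def)
    then have lt: "card ?Y < card X"
      using finX by (metis card_image_le eq_card_imp_inj_on le_neq_implies_less)
    moreover have "?Y \<subseteq> C" using run_closed[of C B \<delta>] cl less.prems v(1) by blast
    ultimately obtain v' where v': "v' \<in> lists B" "length v' \<le> card ?Y * card C ^ 2"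
        "\<forall>p\<in>?Y. \<forall>q\<in>?Y. run \<delta> p v' = run \<delta> q v'"
      using less.hyps by blast
    have "length (v @ v') \<le> (card ?Y + 1) * card C ^ 2" using v v' by simp
    also have "\<dots> \<le> card X * card C ^ 2" using lt by (intro mult_right_mono) auto
    finally have "length (v @ v') \<le> card X * card C ^ 2" .
    moreover have "v @ v' \<in> lists B" using v(1) v'(1) by simp
    moreover have "\<forall>p\<in>X. \<forall>q\<in>X. run \<delta> p (v @ v') = run \<delta> q (v @ v')"
      using v'(3) by (simp only: run_append ball_simps)
    ultimately show ?thesis by blast
  qed
qed

lemma reset_word_via_low_rank:
  assumes fin: "finite Q" and cl: "\<And>q a. q \<in> Q \<Longrightarrow> \<delta> q a \<in> Q"
    and sync: "\<And>p q. p \<in> Q \<Longrightarrow> q \<in> Q \<Longrightarrow> run \<delta> p s = run \<delta> q s"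
    and rank: "card ((\<lambda>q. run \<delta> q w) ` Q) \<le> r"
  obtains v where "length v \<le> length w + r ^ 3 * (card Q + length w)"
    "\<And>p q. p \<in> Q \<Longrightarrow> q \<in> Q \<Longrightarrow> run \<delta> p v = run \<delta> q v"
proof -
  define C where "C = (\<lambda>q. run \<delta> q w) ` Q"
  define B where "B = {u @ w | u. length u \<le> card Q}"
  obtain t where t: "t \<in> lists B" "\<And>p q. p \<in> C \<Longrightarrow> q \<in> C \<Longrightarrow> run (run \<delta>) p t = run (run \<delta>) q t"
    using short_letters_collapse[OF fin cl sync C_def B_def] by metis
  have clw: "run \<delta> q v \<in> Q" if "q \<in> Q" for q v
    using run_closed[of Q UNIV \<delta>] cl that by auto
  have clC: "run \<delta> q b \<in> C" if "q \<in> C" "b \<in> B" for q b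
    using that clw by (auto simp: C_def B_def)
  have finC: "finite C" using fin by (simp add: C_def)
  obtain v where v: "v \<in> lists B" "length v \<le> card C * card C ^ 2"
      "\<forall>p\<in>C. \<forall>q\<in>C. run (run \<delta>) p v = run (run \<delta>) q v"
    using short_collapse[of C B "run \<delta>" t C] finC clC t by blast
  have "length (concat v) \<le> length v * (card Q + length w)"
    using v(1) by (induction v) (auto simp: B_def)
  also have "\<dots> \<le> r ^ 3 * (card Q + length w)"
  proof (rule mult_right_mono)
    have "card C * card C ^ 2 = card C ^ 3" by (simp add: power_numeral_reduce)
    also have "\<dots> \<le> r ^ 3" using rank by (intro power_mono) (auto simp: C_def)
    finally show "length v \<le> r ^ 3" using v(2) by linarith
  qed simp
  finally have "length (w @ concat v) \<le> length w + r ^ 3 * (card Q + length w)" by simp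
  moreover have "run \<delta> p (w @ concat v) = run \<delta> q (w @ concat v)" if "p \<in> Q" "q \<in> Q" for p q
    using v(3) that unfolding C_def run_append run_run by blast
  ultimately show ?thesis using that by blast
qed

section \<open>The leftmost branch of a binary tree\<close>

datatype tree = Leaf | Node tree tree

fun left_height :: "tree \<Rightarrow> nat" where
  "left_height Leaf = 0"
| "left_height (Node l r) = Suc (left_height l)"

definition trees :: "nat \<Rightarrow> tree set" where
  "trees n = {t. size t = n}"

fun inner :: "tree \<Rightarrow> bool list set" where
  "inner Leaf = {}"
| "inner (Node l r) = insert [] (Cons False ` inner l \<union> Cons True ` inner r)"

fun code :: "tree \<Rightarrow> bool list set" where
  "code Leaf = {[]}"
| "code (Node l r) = Cons False ` code l \<union> Cons True ` code r"

lemma finite_trees: "finite (trees n)"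
proof (induction n rule: less_induct)
  case (less n)
  have "trees n \<subseteq> insert Leaf ((\<lambda>(l, r). Node l r) ` ((\<Union>k<n. trees k) \<times> (\<Union>k<n. trees k)))"
  proof
    fix t assume "t \<in> trees n"
    then show "t \<in> insert Leaf ((\<lambda>(l, r). Node l r) ` ((\<Union>k<n. trees k) \<times> (\<Union>k<n. trees k)))"
      by (cases t) (force simp: trees_def)+
  qed
  moreover have "finite \<dots>" using less by auto
  ultimately show ?case using finite_subset by blast
qed

lemma finite_inner [simp]: "finite (inner t)"
  by (induction t) auto

lemma finite_code [simp]: "finite (code t)"
  by (induction t) auto

lemma card_inner: "card (inner t) = size t"
proof (induction t)
  case (Node l r)
  have "card (Cons False ` inner l \<union> Cons True ` inner r) = size l + size r"
    using Node by (subst card_Un_disjoint) (auto simp: card_image)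
  then show ?case by (simp add: card_insert_if image_iff)
qed simp

lemma card_code: "card (code t) = size t + 1"
proof (induction t)
  case (Node l r)
  then show ?case by (simp, subst card_Un_disjoint) (auto simp: card_image)
qed simp

fun graft :: "tree \<Rightarrow> bool list \<Rightarrow> bool \<Rightarrow> tree" where
  "graft t [] b = (if b then Node t Leaf else Node Leaf t)"
| "graft (Node l r) (a # p) b = (if a then Node l (graft r p b) else Node (graft l p b) r)"
| "graft Leaf (a # p) b = Leaf"

lemma leaf_is_grafted:
  assumes "t' \<noteq> Leaf" "p' \<in> code t'"
  shows "\<exists>t p b. p \<in> inner t \<union> code t \<and> t' = graft t p b \<and> p' = p @ [b] \<and> size t' = Suc (size t)"
  using assms
proof (induction t' arbitrary: p')
  case (Node l r)
  have root: "[] \<in> inner t \<union> code t" for t by (cases t) auto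
  from Node.prems consider q where "p' = False # q" "q \<in> code l" | q where "p' = True # q" "q \<in> code r"
    by auto
  then show ?case
  proof cases
    case (1 q)
    show ?thesis
    proof (cases "l = Leaf")
      case True
      then have "Node l r = graft r [] False" "p' = [] @ [False]" "size (Node l r) = Suc (size r)"
        using 1 by auto
      then show ?thesis using root by blast
    next
      case False
      then obtain t p b where t: "p \<in> inner t \<union> code t" "l = graft t p b" "q = p @ [b]" "size l = Suc (size t)"
        using Node.IH(1) 1 by blast
      have "False # p \<in> inner (Node t r) \<union> code (Node t r)" "Node l r = graft (Node t r) (False # p) b"
        "p' = (False # p) @ [b]" "size (Node l r) = Suc (size (Node t r))"
        using t 1 by auto
      then show ?thesis by blast
    qed
  next
    case (2 q)
    show ?thesis
    proof (cases "r = Leaf")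
      case True
      then have "Node l r = graft l [] True" "p' = [] @ [True]" "size (Node l r) = Suc (size l)"
        using 2 by auto
      then show ?thesis using root by blast
    next
      case False
      then obtain t p b where t: "p \<in> inner t \<union> code t" "r = graft t p b" "q = p @ [b]" "size r = Suc (size t)"
        using Node.IH(2) 2 by blast
      have "True # p \<in> inner (Node l t) \<union> code (Node l t)" "Node l r = graft (Node l t) (True # p) b"
        "p' = (True # p) @ [b]" "size (Node l r) = Suc (size (Node l t))"
        using t 2 by auto
      then show ?thesis by blast
    qed
  qed
qed simp

text \<open>Remy's argument: deleting a marked leaf together with its parent leaves a smaller tree with a
  marked vertex and a side, so \<open>n + 2\<close> leaves are traded for at most \<open>2 (2 n + 1)\<close> choices.\<close>
lemma card_trees_Suc_le: "card (trees (Suc n)) \<le> 4 * card (trees n)"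
proof -
  let ?V = "Sigma (trees n) (\<lambda>t. inner t \<union> code t) \<times> (UNIV :: bool set)"
  let ?D = "Sigma (trees (Suc n)) code"
  let ?f = "\<lambda>((t, p), b). (graft t p b, p @ [b])"
  have finV: "finite ?V" using finite_trees by auto
  have "?D \<subseteq> ?f ` ?V"
  proof
    fix x assume "x \<in> ?D"
    then obtain t' p' where x: "x = (t', p')" "size t' = Suc n" "p' \<in> code t'"
      by (auto simp: trees_def)
    moreover from x have "t' \<noteq> Leaf" by auto
    ultimately obtain t p b where "p \<in> inner t \<union> code t" "t' = graft t p b" "p' = p @ [b]" "size t = n"
      using leaf_is_grafted[of t' p'] by (metis Suc_inject)
    then show "x \<in> ?f ` ?V" using x by (intro image_eqI[of _ _ "((t, p), b)"]) (auto simp: trees_def)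
  qed
  then have "card ?D \<le> card ?V"
    using finV by (meson card_image_le card_mono finite_imageI le_trans)
  also have "card ?V = 2 * (\<Sum>t\<in>trees n. card (inner t \<union> code t))"
    using finite_trees by (simp add: card_cartesian_product)
  also have "\<dots> \<le> 2 * (\<Sum>t\<in>trees n. 2 * n + 1)"
    by (intro mult_left_mono sum_mono order.trans[OF card_Un_le]) (auto simp: card_inner card_code trees_def)
  also have "card ?D = (\<Sum>t\<in>trees (Suc n). n + 2)"
    using finite_trees by (simp add: card_code) (auto simp: trees_def)
  finally have "(n + 2) * card (trees (Suc n)) \<le> (4 * n + 2) * card (trees n)"
    by (simp add: algebra_simps)
  also have "\<dots> \<le> (n + 2) * (4 * card (trees n))" by (simp add: algebra_simps)
  finally show ?thesis by (subst (asm) mult_le_cancel1) simp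
qed

fun insert_left :: "tree \<Rightarrow> nat \<Rightarrow> tree" where
  "insert_left t 0 = Node Leaf t"
| "insert_left (Node l r) (Suc i) = Node (insert_left l i) r"
| "insert_left Leaf (Suc i) = Leaf"

lemma left_height_insert_left: "i \<le> left_height t \<Longrightarrow> left_height (insert_left t i) = Suc i"
  by (induction t i rule: insert_left.induct) auto

lemma size_insert_left: "i \<le> left_height t \<Longrightarrow> size (insert_left t i) = Suc (size t)"
  by (induction t i rule: insert_left.induct) auto

lemma insert_left_inject:
  "insert_left t i = insert_left s i \<Longrightarrow> i \<le> left_height t \<Longrightarrow> i \<le> left_height s \<Longrightarrow> t = s"
proof (induction t i arbitrary: s rule: insert_left.induct)
  case (2 l r i)
  then show ?case by (cases s) auto
qed auto

lemma sum_left_height_step: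
  fixes g :: "nat \<Rightarrow> nat"
  shows "(\<Sum>t\<in>trees n. \<Sum>i\<le>left_height t. g (Suc i)) \<le> (\<Sum>t\<in>trees (Suc n). g (left_height t))"
proof -
  let ?S = "Sigma (trees n) (\<lambda>t. {..left_height t})"
  let ?f = "\<lambda>(t, i). insert_left t i"
  have inj: "inj_on ?f ?S"
  proof (rule inj_onI, clarsimp)
    fix t i s j assume *: "insert_left t i = insert_left s j" "i \<le> left_height t" "j \<le> left_height s"
    then have "Suc i = Suc j" by (metis left_height_insert_left)
    with * show "t = s \<and> i = j" using insert_left_inject by auto
  qed
  have "(\<Sum>t\<in>trees n. \<Sum>i\<le>left_height t. g (Suc i)) = (\<Sum>(t, i)\<in>?S. g (Suc i))"
    using finite_trees by (intro sum.Sigma) auto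
  also have "\<dots> = (\<Sum>x\<in>?S. g (left_height (?f x)))"
    by (intro sum.cong) (auto simp: left_height_insert_left)
  also have "\<dots> = (\<Sum>t\<in>?f ` ?S. g (left_height t))"
    by (subst sum.reindex[OF inj]) (simp add: o_def)
  also have "\<dots> \<le> (\<Sum>t\<in>trees (Suc n). g (left_height t))"
    using finite_trees by (intro sum_mono2) (auto simp: trees_def size_insert_left)
  finally show ?thesis .
qed

lemma sum_left_height_cubed:
  "(\<Sum>t\<in>trees n. left_height t ^ 3) \<le> 6 * card (trees (n + 3))"
proof -
  have 1: "(\<Sum>t\<in>trees n. left_height t + 1) \<le> card (trees (Suc n))" for n
    using sum_left_height_step[where n=n and g="\<lambda>_. 1"] by simp
  have sq: "(h + 1) ^ 2 \<le> 2 * (\<Sum>i\<le>h. Suc i + 1)" for h :: nat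
    by (induction h) (auto simp: power2_eq_square)
  have 2: "(\<Sum>t\<in>trees n. (left_height t + 1) ^ 2) \<le> 2 * card (trees (n + 2))" for n
  proof -
    have "(\<Sum>t\<in>trees n. (left_height t + 1) ^ 2) \<le> 2 * (\<Sum>t\<in>trees n. \<Sum>i\<le>left_height t. Suc i + 1)"
      unfolding sum_distrib_left using sq by (intro sum_mono) (simp add: sum_distrib_left)
    also have "\<dots> \<le> 2 * (\<Sum>t\<in>trees (Suc n). left_height t + 1)"
      by (intro mult_left_mono sum_left_height_step) simp
    also have "\<dots> \<le> 2 * card (trees (n + 2))" using 1[of "Suc n"] by simp
    finally show ?thesis .
  qed
  have cu: "h ^ 3 \<le> 3 * (\<Sum>i\<le>h. (Suc i + 1) ^ 2)" for h :: nat
    by (induction h) (auto simp: power2_eq_square power3_eq_cube algebra_simps)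
  have "(\<Sum>t\<in>trees n. left_height t ^ 3) \<le> 3 * (\<Sum>t\<in>trees n. \<Sum>i\<le>left_height t. (Suc i + 1) ^ 2)"
    unfolding sum_distrib_left using cu by (intro sum_mono) (simp add: sum_distrib_left)
  also have "\<dots> \<le> 3 * (\<Sum>t\<in>trees (Suc n). (left_height t + 1) ^ 2)"
    by (intro mult_left_mono sum_left_height_step) simp
  also have "\<dots> \<le> 6 * card (trees (n + 3))" using 2[of "Suc n"] by (simp add: numeral_3_eq_3)
  finally show ?thesis .
qed

section \<open>Decoders as binary trees\<close>

lemma Cons_in_code_iff: "a # u \<in> code (Node l r) \<longleftrightarrow> u \<in> code (if a then r else l)"
  by (cases a) auto

lemma Cons_in_inner_iff: "a # u \<in> inner (Node l r) \<longleftrightarrow> u \<in> inner (if a then r else l)"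
  by (cases a) auto

lemma code_antichain: "u \<in> code t \<Longrightarrow> v \<in> code t \<Longrightarrow> prefix u v \<Longrightarrow> u = v"
  by (induction t arbitrary: u v) auto

lemma code_complete: "\<exists>u\<in>code t. prefix u w \<or> prefix w u"
proof (induction t arbitrary: w)
  case (Node l r)
  show ?case
  proof (cases w)
    case Nil
    then show ?thesis using Node.IH(1)[of "[]"] by auto
  next
    case (Cons a v)
    obtain u where "u \<in> code (if a then r else l)" "prefix u v \<or> prefix v u"
      using Node.IH by (cases a) auto
    then have "a # u \<in> code (Node l r)" "prefix (a # u) w \<or> prefix w (a # u)"
      unfolding Cons_in_code_iff Cons by auto
    then show ?thesis by blast
  qed
qed simp

lemma Nil_in_code_iff: "[] \<in> code t \<longleftrightarrow> t = Leaf"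
  by (cases t) auto

lemma code_nonempty: "code t \<noteq> {}"
  using code_complete by blast

lemma maximal_prefix_code_code:
  assumes "t \<noteq> Leaf"
  shows "maximal_prefix_code (code t)"
  unfolding maximal_prefix_code_def
proof (intro conjI allI impI notI)
  show "prefix_code (code t)"
    using assms code_antichain code_nonempty by (auto simp: prefix_code_def Nil_in_code_iff)
  fix w assume w: "w \<notin> code t" "prefix_code (insert w (code t))"
  obtain u where "u \<in> code t" "prefix u w \<or> prefix w u" using code_complete by blast
  then show False using w unfolding prefix_code_def by blast
qed

lemma complete_antichain_is_code:
  assumes "\<And>u v. u \<in> T \<Longrightarrow> v \<in> T \<Longrightarrow> prefix u v \<Longrightarrow> u = v"
    and "\<And>w. \<exists>u\<in>T. prefix u w \<or> prefix w u"
    and "\<And>u. u \<in> T \<Longrightarrow> length u \<le> k"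
  shows "\<exists>t. T = code t"
  using assms
proof (induction k arbitrary: T)
  case 0
  then have "T = {[]}" by fastforce
  then show ?case by (intro exI[of _ Leaf]) simp
next
  case (Suc k)
  show ?case
  proof (cases "[] \<in> T")
    case True
    then have "T = {[]}" using Suc.prems(1)[of "[]"] by auto
    then show ?thesis by (intro exI[of _ Leaf]) simp
  next
    case False
    have "\<exists>t. {u. a # u \<in> T} = code t" for a
    proof (rule Suc.IH)
      show "u = v" if "u \<in> {u. a # u \<in> T}" "v \<in> {u. a # u \<in> T}" "prefix u v" for u v
        using Suc.prems(1)[of "a # u" "a # v"] that by simp
      show "length u \<le> k" if "u \<in> {u. a # u \<in> T}" for u
        using Suc.prems(3)[of "a # u"] that by simp
      show "\<exists>u\<in>{u. a # u \<in> T}. prefix u w \<or> prefix w u" for w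
      proof -
        obtain u where u: "u \<in> T" "prefix u (a # w) \<or> prefix (a # w) u"
          using Suc.prems(2) by blast
        with False obtain v where "u = a # v" by (cases u) auto
        then show ?thesis using u by auto
      qed
    qed
    then obtain l r where l: "{u. False # u \<in> T} = code l" and r: "{u. True # u \<in> T} = code r"
      by metis
    have "T = code (Node l r)"
    proof (rule set_eqI)
      fix u
      show "u \<in> T \<longleftrightarrow> u \<in> code (Node l r)"
      proof (cases u)
        case Nil
        then show ?thesis using False by auto
      next
        case (Cons a v)
        then show ?thesis using l r by (cases a) auto
      qed
    qed
    then show ?thesis ..
  qed
qed

lemma maximal_prefix_code_iff: "maximal_prefix_code T \<longleftrightarrow> (\<exists>t. t \<noteq> Leaf \<and> T = code t)"
proof
  assume T: "maximal_prefix_code T"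
  then have fin: "finite T" and pc: "prefix_code T" and Nil: "[] \<notin> T"
    by (auto simp: maximal_prefix_code_def prefix_code_def)
  have "\<exists>t. T = code t"
  proof (rule complete_antichain_is_code)
    show "u = v" if "u \<in> T" "v \<in> T" "prefix u v" for u v
      using pc that by (auto simp: prefix_code_def)
    show "length u \<le> Max (length ` T)" if "u \<in> T" for u using fin that by simp
    show "\<exists>u\<in>T. prefix u w \<or> prefix w u" for w
    proof (cases "w = [] \<or> w \<in> T")
      case True
      then show ?thesis using pc by (auto simp: prefix_code_def)
    next
      case False
      then have "\<not> prefix_code (insert w T)" using T by (simp add: maximal_prefix_code_def)
      then show ?thesis using pc False by (auto simp: prefix_code_def)
    qed
  qed
  then show "\<exists>t. t \<noteq> Leaf \<and> T = code t" using Nil Nil_in_code_iff by auto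
qed (auto intro: maximal_prefix_code_code)

lemma inj_code: "inj code"
proof (rule injI)
  show "t = s" if "code t = code s" for t s
    using that
  proof (induction t arbitrary: s)
    case Leaf
    then show ?case using Nil_in_code_iff[of s] by auto
  next
    case (Node l r)
    then have "s \<noteq> Leaf" using Nil_in_code_iff[of "Node l r"] by auto
    then obtain l' r' where s: "s = Node l' r'" by (cases s) auto
    have "code t = {u. False # u \<in> code (Node t t')}" "code t' = {u. True # u \<in> code (Node t t')}" for t t'
      by auto
    then have "code l = code l'" "code r = code r'" using Node.prems s by metis+
    then show ?case using Node.IH s by auto
  qed
qed

lemma dec_states_code: "dec_states (code t) = inner t"
proof (induction t)
  case (Node l r)
  show ?case
  proof (rule set_eqI)
    fix v
    have split: "(\<exists>u\<in>code (Node l r). strict_prefix v u) \<longleftrightarrow>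
        (\<exists>u\<in>code l. strict_prefix v (False # u)) \<or> (\<exists>u\<in>code r. strict_prefix v (True # u))"
      by auto
    show "v \<in> dec_states (code (Node l r)) \<longleftrightarrow> v \<in> inner (Node l r)"
    proof (cases v)
      case Nil
      moreover obtain u where "u \<in> code l" using code_nonempty[of l] by blast
      ultimately show ?thesis unfolding dec_states_def mem_Collect_eq split by auto
    next
      case (Cons a w)
      then have "v \<in> dec_states (code (Node l r)) \<longleftrightarrow> w \<in> dec_states (code (if a then r else l))"
        unfolding dec_states_def mem_Collect_eq split by (cases a) auto
      then show ?thesis using Cons Node.IH by (cases a) auto
    qed
  qed
qed (auto simp: dec_states_def)

lemma decoders_eq:
  assumes "n > 0"
  shows "decoders n = code ` trees n"
proof (rule set_eqI)
  have "t \<noteq> Leaf" if "size t = n" for t using assms that by auto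
  then show "T \<in> decoders n \<longleftrightarrow> T \<in> code ` trees n" for T
    by (auto simp: decoders_def maximal_prefix_code_iff dec_states_code card_inner trees_def)
qed

lemma inner_snoc: "v \<in> inner t \<Longrightarrow> v @ [a] \<in> inner t \<or> v @ [a] \<in> code t"
proof (induction t arbitrary: v)
  case (Node l r)
  have root: "[] \<in> inner t \<or> [] \<in> code t" for t by (cases t) auto
  show ?case
  proof (cases v)
    case Nil
    then show ?thesis using root[of "if a then r else l"] by (cases a) auto
  next
    case (Cons b w)
    then have "w \<in> inner (if b then r else l)" using Node.prems Cons_in_inner_iff by simp
    then show ?thesis
      unfolding Cons append_Cons Cons_in_code_iff Cons_in_inner_iff using Node.IH by (cases b) auto
  qed
qed simp

lemma dec_delta_closed:
  assumes "q \<in> inner t"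
  shows "dec_delta (code t) q a \<in> inner t"
proof -
  have "[] \<in> inner t" using assms by (cases t) auto
  then show ?thesis using inner_snoc[OF assms] by (auto simp: dec_delta_def)
qed

lemma length_inner_less: "v \<in> inner t \<Longrightarrow> length v < size t"
  by (induction t arbitrary: v) fastforce+

lemma left_branch_code: "replicate i False \<in> code t \<longleftrightarrow> i = left_height t"
proof (induction t arbitrary: i)
  case (Node l r)
  then show ?case by (cases i) auto
qed auto

text \<open>Reading zeros, a state either walks down to a leaf, which happens within \<open>size t\<close> steps,
  or is already on the leftmost branch, which it never leaves.\<close>
lemma run_zeros:
  assumes q: "q \<in> inner t"
  shows "run (dec_delta (code t)) q (replicate (size t) False) \<in> (\<lambda>i. replicate i False) ` {..<left_height t}"
proof -
  let ?\<delta> = "dec_delta (code t)" and ?Z = "(\<lambda>i. replicate i False) ` {..<left_height t}"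
  have h: "left_height t > 0" using q by (cases t) auto
  have closed: "?\<delta> z False \<in> ?Z" if z: "z \<in> ?Z" for z
  proof -
    obtain i where i: "z = replicate i False" "i < left_height t" using z by auto
    have snoc: "z @ [False] = replicate (Suc i) False" using i by (simp add: replicate_append_same)
    show ?thesis
    proof (cases "Suc i = left_height t")
      case True
      then have "?\<delta> z False = replicate 0 False"
        unfolding dec_delta_def snoc left_branch_code by simp
      then show ?thesis using h by blast
    next
      case False
      then have "?\<delta> z False = replicate (Suc i) False"
        unfolding dec_delta_def snoc left_branch_code by simp
      moreover have "Suc i \<in> {..<left_height t}" using i False by simp
      ultimately show ?thesis by blast
    qed
  qed
  have step: "run ?\<delta> q (replicate k False) \<in> ?Z \<or>
      run ?\<delta> q (replicate k False) = q @ replicate k False \<and> q @ replicate k False \<in> inner t" for k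
  proof (induction k)
    case 0
    then show ?case using q by simp
  next
    case (Suc k)
    define z where "z = run ?\<delta> q (replicate k False)"
    have run_Suc: "run ?\<delta> q (replicate (Suc k) False) = ?\<delta> z False"
      unfolding z_def replicate_Suc replicate_append_same[symmetric] by simp
    from Suc consider "z \<in> ?Z" | "z = q @ replicate k False" "z \<in> inner t"
      unfolding z_def by auto
    then show ?case
    proof cases
      case 1
      then show ?thesis unfolding run_Suc using closed by blast
    next
      case 2
      have snoc: "z @ [False] = q @ replicate (Suc k) False"
        using 2 by (simp add: replicate_append_same)
      show ?thesis
      proof (cases "z @ [False] \<in> code t")
        case True
        then have "?\<delta> z False = replicate 0 False" by (simp add: dec_delta_def)
        then show ?thesis unfolding run_Suc using h by blast
      next
        case False
        then show ?thesis
          unfolding run_Suc using inner_snoc[OF 2(2), of False] snoc by (simp add: dec_delta_def)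
      qed
    qed
  qed
  have "q @ replicate (size t) False \<notin> inner t" using length_inner_less by fastforce
  then show ?thesis using step[of "size t"] by blast
qed

lemma dec_delta_word_run: "dec_delta_word T q w = run (dec_delta T) q w"
  unfolding dec_delta_word_def by (induction w arbitrary: q) auto

lemma synchronizing_word_code_iff:
  assumes "t \<noteq> Leaf"
  shows "synchronizing_word (code t) w \<longleftrightarrow>
    (\<forall>p\<in>inner t. \<forall>q\<in>inner t. run (dec_delta (code t)) p w = run (dec_delta (code t)) q w)"
proof -
  let ?r = "\<lambda>q. run (dec_delta (code t)) q w"
  have root: "[] \<in> inner t" using assms by (cases t) auto
  have "card (?r ` inner t) = 1 \<longleftrightarrow> (\<forall>p\<in>inner t. \<forall>q\<in>inner t. ?r p = ?r q)"
  proof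
    assume "card (?r ` inner t) = 1"
    then obtain x where x: "?r ` inner t = {x}" by (rule card_1_singletonE)
    have "?r q = x" if "q \<in> inner t" for q
      using imageI[OF that, of ?r] unfolding x by (rule singletonD)
    then show "\<forall>p\<in>inner t. \<forall>q\<in>inner t. ?r p = ?r q" by simp
  next
    assume "\<forall>p\<in>inner t. \<forall>q\<in>inner t. ?r p = ?r q"
    then have "?r ` inner t = {?r []}" using root by blast
    then show "card (?r ` inner t) = 1" by simp
  qed
  then show ?thesis
    unfolding synchronizing_word_def dec_states_code dec_delta_word_run .
qed

lemma reset_threshold_code_le:
  assumes t: "t \<noteq> Leaf" and sync: "synchronizing (code t)"
  shows "reset_threshold (code t) \<le> 3 * size t * left_height t ^ 3"
proof -
  let ?\<delta> = "dec_delta (code t)" and ?w = "replicate (size t) False" and ?h = "left_height t"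
  obtain s where s: "\<forall>p\<in>inner t. \<forall>q\<in>inner t. run ?\<delta> p s = run ?\<delta> q s"
    using sync synchronizing_word_code_iff[OF t] by (auto simp: synchronizing_def)
  have "card ((\<lambda>q. run ?\<delta> q ?w) ` inner t) \<le> card ((\<lambda>i. replicate i False) ` {..<?h})"
    using run_zeros by (intro card_mono) auto
  also have "\<dots> \<le> ?h" using card_image_le[of "{..<?h}"] by simp
  finally have rank: "card ((\<lambda>q. run ?\<delta> q ?w) ` inner t) \<le> ?h" .
  obtain v where v: "length v \<le> length ?w + ?h ^ 3 * (card (inner t) + length ?w)"
      "\<And>p q. p \<in> inner t \<Longrightarrow> q \<in> inner t \<Longrightarrow> run ?\<delta> p v = run ?\<delta> q v"
    using reset_word_via_low_rank[OF finite_inner dec_delta_closed _ rank] s by blast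
  have "reset_threshold (code t) \<le> length v"
    unfolding reset_threshold_def
  proof (rule Least_le)
    have "synchronizing_word (code t) v"
      unfolding synchronizing_word_code_iff[OF t] using v(2) by blast
    then show "\<exists>w. length w = length v \<and> synchronizing_word (code t) w" by blast
  qed
  also have "\<dots> \<le> size t * 1 + 2 * size t * ?h ^ 3"
    using v(1) by (simp add: card_inner algebra_simps)
  also have "\<dots> \<le> size t * ?h ^ 3 + 2 * size t * ?h ^ 3"
  proof -
    have "?h \<ge> 1" using t by (cases t) auto
    then have "1 \<le> ?h ^ 3" by (rule one_le_power)
    then have "size t * 1 \<le> size t * ?h ^ 3" by (rule mult_left_mono) simp
    then show ?thesis by (rule add_right_mono)
  qed
  finally show ?thesis by simp
qed

lemma card_trees_le_card_sync_decoders: "card (trees n) \<le> card (sync_decoders (Suc n))"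
proof -
  have "code (Node Leaf t) \<in> sync_decoders (Suc n)" if t: "t \<in> trees n" for t
  proof -
    let ?w = "replicate (size (Node Leaf t)) False"
    have "run (dec_delta (code (Node Leaf t))) q ?w = []" if "q \<in> inner (Node Leaf t)" for q
    proof -
      have "run (dec_delta (code (Node Leaf t))) q ?w \<in> (\<lambda>i. replicate i False) ` {..<left_height (Node Leaf t)}"
        using that by (rule run_zeros)
      also have "\<dots> = {[]}" by (simp add: lessThan_Suc)
      finally show ?thesis by (rule singletonD)
    qed
    then have "synchronizing_word (code (Node Leaf t)) ?w"
      by (subst synchronizing_word_code_iff) (simp_all del: inner.simps code.simps)
    then have "synchronizing (code (Node Leaf t))" unfolding synchronizing_def ..
    moreover have "Node Leaf t \<in> trees (Suc n)" using t by (simp add: trees_def)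
    ultimately show ?thesis by (simp add: sync_decoders_def decoders_eq del: code.simps)
  qed
  moreover have "inj_on (\<lambda>t. code (Node Leaf t)) (trees n)"
    by (rule inj_onI) (metis injD[OF inj_code] tree.inject)
  moreover have "finite (sync_decoders (Suc n))"
    using finite_trees by (simp add: sync_decoders_def decoders_eq)
  ultimately show ?thesis by (intro card_inj_on_le[of "\<lambda>t. code (Node Leaf t)"]) auto
qed

lemma expected_reset_threshold_le:
  assumes "n > 0"
  shows "expected_reset_threshold n \<le> 4608 * real n"
proof -
  have "(\<Sum>T\<in>sync_decoders n. reset_threshold T)
      = (\<Sum>t\<in>{t \<in> trees n. synchronizing (code t)}. reset_threshold (code t))"
  proof -
    have "sync_decoders n = code ` {t \<in> trees n. synchronizing (code t)}"
      using decoders_eq[OF assms] by (auto simp: sync_decoders_def)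
    moreover have "inj_on code A" for A using inj_code by (rule inj_on_subset) simp
    ultimately show ?thesis by (simp add: sum.reindex)
  qed
  also have "\<dots> \<le> (\<Sum>t\<in>{t \<in> trees n. synchronizing (code t)}. 3 * n * left_height t ^ 3)"
  proof (rule sum_mono)
    fix t assume "t \<in> {t \<in> trees n. synchronizing (code t)}"
    then have "size t = n" "t \<noteq> Leaf" "synchronizing (code t)" using assms by (auto simp: trees_def)
    then show "reset_threshold (code t) \<le> 3 * n * left_height t ^ 3"
      using reset_threshold_code_le by blast
  qed
  also have "\<dots> \<le> (\<Sum>t\<in>trees n. 3 * n * left_height t ^ 3)"
    using finite_trees by (intro sum_mono2) auto
  also have "\<dots> \<le> 3 * n * (6 * card (trees (n + 3)))"
    unfolding sum_distrib_left[symmetric] by (intro mult_left_mono sum_left_height_cubed) simp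
  also have "\<dots> \<le> 3 * n * (6 * (256 * card (sync_decoders n)))"
  proof -
    obtain m where m: "n = Suc m" using assms by (cases n) auto
    have "card (trees (n + 3)) \<le> 256 * card (trees m)"
      using card_trees_Suc_le[of m] card_trees_Suc_le[of "Suc m"]
        card_trees_Suc_le[of "Suc (Suc m)"] card_trees_Suc_le[of "Suc (Suc (Suc m))"]
      by (simp add: m numeral_3_eq_3)
    then have "card (trees (n + 3)) \<le> 256 * card (sync_decoders n)"
      using card_trees_le_card_sync_decoders[of m] m by simp
    then show ?thesis by (intro mult_left_mono) auto
  qed
  finally have "(\<Sum>T\<in>sync_decoders n. reset_threshold T) \<le> 4608 * n * card (sync_decoders n)"
    by simp
  then have "real (\<Sum>T\<in>sync_decoders n. reset_threshold T) \<le> real (4608 * n * card (sync_decoders n))"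
    by (rule of_nat_mono)
  then show ?thesis
    by (cases "card (sync_decoders n) = 0") (simp_all add: expected_reset_threshold_def divide_le_eq)
qed

theorem theorem6:
  shows "(\<lambda>n. expected_reset_threshold n) \<in> O(\<lambda>n. real n * ln (real n))"
proof (rule bigoI)
  show "\<forall>\<^sub>F n in sequentially. norm (expected_reset_threshold n) \<le> 4608 * norm (real n * ln (real n))"
    using eventually_ge_at_top[of 3]
  proof eventually_elim
    case (elim n)
    have "1 \<le> ln (real n)" using elim exp_le by (subst ln_ge_iff) auto
    then have "real n * 1 \<le> real n * ln (real n)" by (intro mult_left_mono) auto
    moreover have "0 \<le> expected_reset_threshold n"
      by (simp add: expected_reset_threshold_def sum_nonneg)
    moreover have "expected_reset_threshold n \<le> 4608 * real n"
      using expected_reset_threshold_le elim by simp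
    ultimately show ?case by simp
  qed
qed

end
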